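(* Let $k\ge 2$, let $J\subseteq C(n,k)$ be a realizable $k$-set, and let $\rho$ be an admissible $J$-order. Then $\mathrm{Inv}(\rho)$ is a realizable $(k+1)$-set, i.e. a realizable subset of $C(n,k+1)$.
   Context: $C(n,k)$ is the set of $k$-element subsets of $\{1,\dots,n\}$, with the lexicographic order (compare increasing sequences lexicographically); antilexicographic = reverse. For $X\in C(n,k+1)$, $P_X=\{Y\in C(n,k):Y\subset X\}$ with the induced lexicographic order; prefixes/suffixes of a totally ordered finite set are initial/final segments (possibly empty or all). For $A\subseteq C(n,k)$: $A_p$ (resp. $A_s$) is the set of $X\in C(n,k+1)$ with $P_X\cap A$ a nonempty prefix (resp. suffix) of $P_X$ different from $P_X$; $A_F=\{X:P_X\subseteq A\}$; $A_\emptyset=\{X:P_X\cap A=\emptyset\}$. $A$ is realizable if $P_X\cap A$ is a prefix or suffix of $P_X$ for all $X\in C(n,k+1)$. An admissible $J$-order is a total order $\rho$ on $J$ inducing the antilexicographic order on $P_X\cap J$ for $X\in J_s$, the lexicographic order on $P_X\cap J$ for $X\in J_p$, and the lexicographic or antilexicographic order on $P_X$ for $X\in J_F$. $\mathrm{Inv}(\rho)=J_s\cup\{X\in J_F:\rho|_{P_X}\text{ antilexicographic}\}$. *)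

theory Defs
  imports Main
begin

definition C :: "nat \<Rightarrow> nat \<Rightarrow> nat set set" where
  "C n k = {Y. Y \<subseteq> {1..n} \<and> card Y = k}"

(* Orders are reflexive relations, as in linear_order_on. A finite set is compared
   via its increasing enumeration; lex_order is only meant for finite sets. *)
definition lex_order :: "nat set rel" where
  "lex_order = {(Y, Z). Y = Z \<or>
     (sorted_list_of_set Y, sorted_list_of_set Z) \<in> lexord {(a, b). a < b}}"

definition antilex_order :: "nat set rel" where
  "antilex_order = lex_order\<inverse>"

(* The set P_X, for X in C n (k + 1). *)
definition packet :: "nat \<Rightarrow> nat \<Rightarrow> nat set \<Rightarrow> nat set set" where
  "packet n k X = {Y \<in> C n k. Y \<subset> X}"

definition is_prefix :: "'a rel \<Rightarrow> 'a set \<Rightarrow> 'a set \<Rightarrow> bool" where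
  "is_prefix r P S \<longleftrightarrow> S \<subseteq> P \<and> (\<forall>b\<in>S. \<forall>a\<in>P. (a, b) \<in> r \<longrightarrow> a \<in> S)"

definition is_suffix :: "'a rel \<Rightarrow> 'a set \<Rightarrow> 'a set \<Rightarrow> bool" where
  "is_suffix r P S \<longleftrightarrow> S \<subseteq> P \<and> (\<forall>a\<in>S. \<forall>b\<in>P. (a, b) \<in> r \<longrightarrow> b \<in> S)"

definition prefix_part :: "nat \<Rightarrow> nat \<Rightarrow> nat set set \<Rightarrow> nat set set" where
  "prefix_part n k A = {X \<in> C n (k + 1).
     is_prefix lex_order (packet n k X) (packet n k X \<inter> A) \<and>
     packet n k X \<inter> A \<noteq> {} \<and> packet n k X \<inter> A \<noteq> packet n k X}"

definition suffix_part :: "nat \<Rightarrow> nat \<Rightarrow> nat set set \<Rightarrow> nat set set" where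
  "suffix_part n k A = {X \<in> C n (k + 1).
     is_suffix lex_order (packet n k X) (packet n k X \<inter> A) \<and>
     packet n k X \<inter> A \<noteq> {} \<and> packet n k X \<inter> A \<noteq> packet n k X}"

definition full_part :: "nat \<Rightarrow> nat \<Rightarrow> nat set set \<Rightarrow> nat set set" where
  "full_part n k A = {X \<in> C n (k + 1). packet n k X \<subseteq> A}"

definition realizable :: "nat \<Rightarrow> nat \<Rightarrow> nat set set \<Rightarrow> bool" where
  "realizable n k A \<longleftrightarrow> A \<subseteq> C n k \<and>
     (\<forall>X\<in>C n (k + 1). is_prefix lex_order (packet n k X) (packet n k X \<inter> A) \<or>
                      is_suffix lex_order (packet n k X) (packet n k X \<inter> A))"

definition induces_on :: "'a rel \<Rightarrow> 'a rel \<Rightarrow> 'a set \<Rightarrow> bool" where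
  "induces_on \<rho> r P \<longleftrightarrow> \<rho> \<inter> P \<times> P = r \<inter> P \<times> P"

definition admissible_order :: "nat \<Rightarrow> nat \<Rightarrow> nat set set \<Rightarrow> nat set rel \<Rightarrow> bool" where
  "admissible_order n k J \<rho> \<longleftrightarrow> linear_order_on J \<rho> \<and>
     (\<forall>X\<in>suffix_part n k J. induces_on \<rho> antilex_order (packet n k X \<inter> J)) \<and>
     (\<forall>X\<in>prefix_part n k J. induces_on \<rho> lex_order (packet n k X \<inter> J)) \<and>
     (\<forall>X\<in>full_part n k J. induces_on \<rho> lex_order (packet n k X) \<or>
                          induces_on \<rho> antilex_order (packet n k X))"

definition Inv :: "nat \<Rightarrow> nat \<Rightarrow> nat set set \<Rightarrow> nat set rel \<Rightarrow> nat set set" where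
  "Inv n k J \<rho> = suffix_part n k J \<union>
     {X \<in> full_part n k J. induces_on \<rho> antilex_order (packet n k X)}"

end

(* Write the packet of W in C(n,k+2) as {W - {i} | i in W} and view the sets W - {i,j} lying in J as
   the edges ij of a graph on W; lexicographic order on a packet is the descending order of the
   removed element. If Inv(rho) met this packet neither in a prefix nor in a suffix, there would be
   i < j < l in W with the membership of j different from that of i and l. The local conditions at
   i, j, l then turn any edge of the triangle ijl into a rho-cycle of length three, so the triangle
   has no edge, and following an edge that must exist at a vertex of suffix type leads to a vertex
   whose neighbourhood is neither an initial nor a final segment. *)
theory Submission
  imports Defs
begin

section \<open>Lexicographic order on packets, read off the removed elements\<close>

lemma lex_order_remove_less:
  assumes "finite X" "a \<in> X" "b \<in> X" "a < b"
  shows "(sorted_list_of_set (X - {b}), sorted_list_of_set (X - {a})) \<in> lexord {(a, b). a < b}"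
proof -
  obtain xs ys where s: "sorted_list_of_set X = xs @ a # ys"
    using assms(1,2) by (metis set_sorted_list_of_set split_list)
  have X: "X = set (xs @ a # ys)"
    using s assms(1) by (metis set_sorted_list_of_set)
  have srt: "sorted_wrt (<) (xs @ a # ys)"
    using s strict_sorted_list_of_set by metis
  have b: "b \<in> set ys"
    using srt X assms(3,4) by (auto simp: sorted_wrt_append)
  \<comment> \<open>Since \<open>b\<close> lies in \<open>ys\<close>, \<open>a\<close> has a
    successor \<open>y\<close> in \<open>X\<close>. After the common part \<open>xs\<close>,
    \<open>X - {b}\<close> continues with \<open>a\<close> and \<open>X - {a}\<close> with the
    larger \<open>y\<close>.\<close>
  then obtain y zs where ys: "ys = y # zs"
    by (cases ys) auto
  have "X - {b} = set (xs @ a # filter (\<lambda>z. z \<noteq> b) ys)"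
    using X srt assms(4) b by (auto simp: sorted_wrt_append)
  moreover have "sorted_wrt (<) (xs @ a # filter (\<lambda>z. z \<noteq> b) ys)"
    using srt by (auto simp: sorted_wrt_append sorted_wrt_filter)
  ultimately have sb: "sorted_list_of_set (X - {b}) = xs @ a # filter (\<lambda>z. z \<noteq> b) ys"
    by (metis sorted_list_of_set.idem_if_sorted_distinct strict_sorted_iff)
  have "X - {a} = set (xs @ ys)"
    using X srt by (auto simp: sorted_wrt_append)
  moreover have "sorted_wrt (<) (xs @ ys)"
    using srt by (auto simp: sorted_wrt_append)
  ultimately have sa: "sorted_list_of_set (X - {a}) = xs @ ys"
    by (metis sorted_list_of_set.idem_if_sorted_distinct strict_sorted_iff)
  have "a < y"
    using srt ys by (auto simp: sorted_wrt_append)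
  then show ?thesis
    unfolding sa sb ys by (auto intro: lexord_append_leftI)
qed

lemma lex_order_remove_iff:
  assumes "finite X" "a \<in> X" "b \<in> X"
  shows "(X - {a}, X - {b}) \<in> lex_order \<longleftrightarrow> b \<le> a"
proof (cases a b rule: linorder_cases)
  case less
  have "asym (lexord {(a::nat, b). a < b})"
    by (rule lexord_asym) (auto intro: asymI)
  then have "(sorted_list_of_set (X - {a}), sorted_list_of_set (X - {b})) \<notin> lexord {(a, b). a < b}"
    using lex_order_remove_less[OF assms less] by (meson asymD)
  moreover have "X - {a} \<noteq> X - {b}"
    using assms less by auto
  ultimately show ?thesis
    using less by (auto simp: lex_order_def)
next
  case greater
  then show ?thesis
    using lex_order_remove_less[OF assms(1,3,2) greater] by (simp add: lex_order_def)
qed (simp add: lex_order_def)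

lemma packet_eq:
  assumes "X \<in> C n (k + 1)"
  shows "packet n k X = (\<lambda>a. X - {a}) ` X"
proof (intro equalityI subsetI)
  fix Y assume "Y \<in> packet n k X"
  then have Y: "Y \<subset> X" "card Y = k"
    by (auto simp: packet_def C_def)
  have X: "finite X" "card X = k + 1"
    using assms by (auto simp: C_def intro: finite_subset)
  have "card (X - Y) = 1"
    using X Y card_Diff_subset[of Y X] finite_subset[of Y X] by auto
  then obtain a where "X - Y = {a}"
    by (auto simp: card_1_singleton_iff)
  then have "a \<in> X" "Y = X - {a}"
    using Y by auto
  then show "Y \<in> (\<lambda>a. X - {a}) ` X"
    by blast
next
  fix Y assume "Y \<in> (\<lambda>a. X - {a}) ` X"
  then show "Y \<in> packet n k X"
    using assms by (auto simp: packet_def C_def)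
qed

lemma finite_C: "X \<in> C n k \<Longrightarrow> finite X"
  by (auto simp: C_def intro: finite_subset)

text \<open>As the order runs downwards in the removed element, prefixes become up-closed sets of
  removed elements, and suffixes down-closed ones.\<close>

lemma is_prefix_packet_iff:
  assumes "X \<in> C n (k + 1)"
  shows "is_prefix lex_order (packet n k X) (packet n k X \<inter> A) \<longleftrightarrow>
    (\<forall>a\<in>X. \<forall>b\<in>X. a < b \<longrightarrow> X - {a} \<in> A \<longrightarrow> X - {b} \<in> A)"
  unfolding is_prefix_def packet_eq[OF assms]
  using lex_order_remove_iff[OF finite_C[OF assms]]
  by (auto simp: order_le_less)

lemma is_suffix_packet_iff:
  assumes "X \<in> C n (k + 1)"
  shows "is_suffix lex_order (packet n k X) (packet n k X \<inter> A) \<longleftrightarrow>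
    (\<forall>a\<in>X. \<forall>b\<in>X. a < b \<longrightarrow> X - {b} \<in> A \<longrightarrow> X - {a} \<in> A)"
  unfolding is_suffix_def packet_eq[OF assms]
  using lex_order_remove_iff[OF finite_C[OF assms]]
  by (auto simp: order_le_less)

section \<open>Local conditions at members and non-members of \<open>Inv\<close>\<close>

lemma InvD:
  assumes "admissible_order n k J \<rho>" "X \<in> Inv n k J \<rho>"
    and "a \<in> X" "b \<in> X" "a < b" "X - {b} \<in> J"
  shows "X - {a} \<in> J" "(X - {a}, X - {b}) \<in> \<rho>"
proof -
  have X: "X \<in> C n (k + 1)"
    using assms(2) by (auto simp: Inv_def suffix_part_def full_part_def)
  have P: "X - {a} \<in> packet n k X" "X - {b} \<in> packet n k X"
    using packet_eq[OF X] assms by auto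
  \<comment> \<open>Antilexicographic means ascending in the removed element. Both parts of
    \<open>Inv\<close> carry this order, on \<open>packet n k X \<inter> J\<close> or on the whole
    packet.\<close>
  have lex: "(X - {a}, X - {b}) \<in> antilex_order"
    using lex_order_remove_iff[OF finite_C[OF X] assms(4,3)] assms(5) by (simp add: antilex_order_def)
  show J: "X - {a} \<in> J"
    using assms(2)
  proof (unfold Inv_def, elim UnE)
    assume "X \<in> suffix_part n k J"
    then show ?thesis
      using is_suffix_packet_iff[OF X, of J] assms by (auto simp: suffix_part_def)
  next
    assume "X \<in> {X \<in> full_part n k J. induces_on \<rho> antilex_order (packet n k X)}"
    then show ?thesis
      using P by (auto simp: full_part_def)
  qed
  have "induces_on \<rho> antilex_order (packet n k X \<inter> J) \<or> induces_on \<rho> antilex_order (packet n k X)"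
    using assms(1,2) by (auto simp: Inv_def admissible_order_def)
  then show "(X - {a}, X - {b}) \<in> \<rho>"
    using P J assms(6) lex unfolding induces_on_def by blast
qed

text \<open>Mirror image of \<open>InvD\<close>: once the packet meets \<open>J\<close>,
  realizability leaves only the proper prefix and the full case, and in the latter admissibility
  forces the lexicographic order.\<close>

lemma not_InvD:
  assumes "realizable n k J" "admissible_order n k J \<rho>" "X \<in> C n (k + 1)" "X \<notin> Inv n k J \<rho>"
    and "a \<in> X" "b \<in> X" "a < b" "X - {a} \<in> J"
  shows "X - {b} \<in> J" "(X - {b}, X - {a}) \<in> \<rho>"
proof -
  note X = assms(3)
  have P: "X - {a} \<in> packet n k X" "X - {b} \<in> packet n k X"
    using packet_eq[OF X] assms by auto
  have lex: "(X - {b}, X - {a}) \<in> lex_order"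
    using lex_order_remove_iff[OF finite_C[OF X] assms(6,5)] assms(7) by simp
  have "packet n k X \<inter> J \<noteq> {}"
    using P assms(8) by auto
  moreover have "is_prefix lex_order (packet n k X) (packet n k X \<inter> J) \<or>
      is_suffix lex_order (packet n k X) (packet n k X \<inter> J)"
    using assms(1) X by (auto simp: realizable_def)
  ultimately have c: "X \<in> prefix_part n k J \<or> X \<in> full_part n k J"
    using assms(4) X by (auto simp: Inv_def prefix_part_def suffix_part_def full_part_def)
  show J: "X - {b} \<in> J"
    using c
  proof
    assume "X \<in> prefix_part n k J"
    then show ?thesis
      using is_prefix_packet_iff[OF X, of J] assms by (auto simp: prefix_part_def)
  next
    assume "X \<in> full_part n k J"
    then show ?thesis
      using P by (auto simp: full_part_def)
  qed
  have "induces_on \<rho> lex_order (packet n k X \<inter> J) \<or> induces_on \<rho> lex_order (packet n k X)"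
    using c assms(2,4) by (auto simp: Inv_def admissible_order_def)
  then show "(X - {b}, X - {a}) \<in> \<rho>"
    using P J assms(8) lex unfolding induces_on_def by blast
qed

text \<open>Supplies the starting edge at a vertex of suffix type. In the full case it comes from
  the packet itself being nonempty.\<close>

lemma Inv_meets_packet:
  assumes "X \<in> Inv n k J \<rho>" "X \<noteq> {}"
  shows "\<exists>a\<in>X. X - {a} \<in> J"
proof -
  have X: "X \<in> C n (k + 1)"
    using assms by (auto simp: Inv_def suffix_part_def full_part_def)
  have "packet n k X \<noteq> {}"
    using assms(2) packet_eq[OF X] by simp
  then have "packet n k X \<inter> J \<noteq> {}"
    using assms(1) unfolding Inv_def suffix_part_def full_part_def by blast
  then show ?thesis
    using packet_eq[OF X] by auto
qed

section \<open>The triangle argument on the graph of \<open>J\<close>\<close>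

text \<open>Here \<open>E\<close> is the graph formed by \<open>J\<close> inside a set \<open>W\<close>, \<open>I\<close> marks the removed elements
  whose complement lies in \<open>Inv\<close>, and \<open>R i j l\<close> says that the edge \<open>ij\<close> precedes the edge \<open>il\<close>.\<close>

lemma inversions_not_alternating:
  fixes W :: "'a::linorder set" and E :: "'a \<Rightarrow> 'a \<Rightarrow> bool"
  assumes sym: "\<And>i j. E i j \<longleftrightarrow> E j i"
    and seg: "\<And>i. i \<in> W \<Longrightarrow>
      (\<forall>a\<in>W - {i}. \<forall>b\<in>W - {i}. a < b \<longrightarrow> E i a \<longrightarrow> E i b) \<or>
      (\<forall>a\<in>W - {i}. \<forall>b\<in>W - {i}. a < b \<longrightarrow> E i b \<longrightarrow> E i a)"
    and inv: "\<And>i a b. \<lbrakk>i \<in> W; I i; a \<in> W - {i}; b \<in> W - {i}; a < b; E i b\<rbrakk> \<Longrightarrow> E i a \<and> R i a b"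
    and noninv: "\<And>i a b. \<lbrakk>i \<in> W; \<not> I i; a \<in> W - {i}; b \<in> W - {i}; a < b; E i a\<rbrakk>
      \<Longrightarrow> E i b \<and> R i b a"
    and ne: "\<And>i. \<lbrakk>i \<in> W; I i\<rbrakk> \<Longrightarrow> \<exists>a\<in>W - {i}. E i a"
    and acyc1: "\<And>i j l. \<lbrakk>i \<in> W; j \<in> W; l \<in> W; i < j; j < l; R i j l; R l i j; R j l i\<rbrakk> \<Longrightarrow> False"
    and acyc2: "\<And>i j l. \<lbrakk>i \<in> W; j \<in> W; l \<in> W; i < j; j < l; R i l j; R l j i; R j i l\<rbrakk> \<Longrightarrow> False"
    and W: "i \<in> W" "j \<in> W" "l \<in> W" "i < j" "j < l"
    and alt: "I i \<noteq> I j" "I j \<noteq> I l"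
  shows False
proof -
  have gap: False
    if "a \<in> W" "x \<in> W - {a}" "y \<in> W - {a}" "z \<in> W - {a}" "x < y" "y < z"
      and "E a x \<noteq> E a y" "E a y \<noteq> E a z" for a x y z
    using seg[OF that(1)]
  proof
    assume "\<forall>u\<in>W - {a}. \<forall>v\<in>W - {a}. u < v \<longrightarrow> E a u \<longrightarrow> E a v"
    then show False
      using that by blast
  next
    assume "\<forall>u\<in>W - {a}. \<forall>v\<in>W - {a}. u < v \<longrightarrow> E a v \<longrightarrow> E a u"
    then show False
      using that by blast
  qed
  have neq: "i < l" "i \<noteq> j" "j \<noteq> i" "i \<noteq> l" "l \<noteq> i" "j \<noteq> l" "l \<noteq> j"
    using W by auto
  show False
  proof (cases "I j")
    case True
    then have I: "\<not> I i" "\<not> I l"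
      using alt by auto
    \<comment> \<open>The implications run round the triangle, so one edge yields all three, with
      \<open>il\<close> before \<open>ij\<close> before \<open>jl\<close> before
      \<open>il\<close>.\<close>
    have 1: "E i j \<Longrightarrow> E i l \<and> R i l j" "E j l \<Longrightarrow> E i j \<and> R j i l" "E i l \<Longrightarrow> E j l \<and> R l j i"
      using noninv[of i j l] inv[of j i l] noninv[of l i j] I True W neq sym by auto
    have no: "\<not> E i j" "\<not> E i l" "\<not> E j l"
      using 1 acyc2[OF W] by blast+
    obtain a where a: "a \<in> W" "a \<noteq> j" "E j a"
      using ne[of j] True W neq by auto
    have "a < i"
    proof (rule ccontr)
      assume "\<not> a < i"
      then have "i = a \<or> i < a"
        by auto
      then show False
        using inv[of j i a] a True W neq no sym by auto
    qed
    then have a_neq: "a \<noteq> i" "a \<noteq> l" "i \<noteq> a" "l \<noteq> a" "a < j"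
      using W by auto
    \<comment> \<open>At \<open>i\<close> and \<open>l\<close> edges propagate upwards, so an edge
      to \<open>a\<close> would force one to \<open>j\<close>. Hence \<open>a\<close> sees
      \<open>j\<close> but neither \<open>i\<close> nor \<open>l\<close>, against
      \<open>gap\<close>.\<close>
    then have "\<not> E a i" "\<not> E a l"
      using noninv[of i a j] noninv[of l a j] I W neq no a sym by auto
    then show False
      using gap[of a i j l] a W a_neq \<open>\<not> E a i\<close> \<open>\<not> E a l\<close> sym by auto
  next
    case False
    then have I: "I i" "I l"
      using alt by auto
    \<comment> \<open>The opposite cycle: \<open>ij\<close> before \<open>il\<close> before
      \<open>jl\<close> before \<open>ij\<close>.\<close>
    have 1: "E i l \<Longrightarrow> E i j \<and> R i j l" "E j l \<Longrightarrow> E i l \<and> R l i j" "E i j \<Longrightarrow> E j l \<and> R j l i"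
      using inv[of i j l] noninv[of j i l] inv[of l i j] I False W sym by auto
    have no: "\<not> E i j" "\<not> E i l" "\<not> E j l"
      using 1 acyc1[OF W] by blast+
    obtain b where b: "b \<in> W" "b \<noteq> l" "E l b"
      using ne[of l] I W neq by auto
    have "b < i"
    proof (rule ccontr)
      assume "\<not> b < i"
      then have "i = b \<or> i < b"
        by auto
      then show False
        using inv[of l i b] b I W neq no sym by auto
    qed
    have b_neq: "b \<noteq> i" "b \<noteq> j" "i \<noteq> b" "j \<noteq> b" "b < j" "b < l"
      using W \<open>b < i\<close> by auto
    have "\<not> E b j"
      using noninv[of j b l] False W neq no b b_neq sym by auto
    then have "\<not> E b i"
      using gap[of b i j l] b W neq \<open>b < i\<close> b_neq \<open>\<not> E b j\<close> sym by auto
    \<comment> \<open>The vertex \<open>b\<close> sees only \<open>l\<close> in the triangle, which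
      is no contradiction yet, so a neighbour of \<open>i\<close> is needed as well.\<close>
    obtain a where a: "a \<in> W" "a \<noteq> i" "E i a"
      using ne[of i] I W neq by auto
    have "a < b"
    proof (rule ccontr)
      assume "\<not> a < b"
      then have "b = a \<or> b < a"
        by auto
      then show False
        using inv[of i b a] a b I W neq \<open>\<not> E b i\<close> \<open>b < i\<close> sym by auto
    qed
    have a_neq: "a < i" "a < j" "a < l" "a \<noteq> j" "a \<noteq> l" "i \<noteq> a" "j \<noteq> a" "l \<noteq> a"
      using W \<open>a < b\<close> \<open>b < i\<close> by auto
    \<comment> \<open>Edges at \<open>l\<close> propagate downwards from \<open>b\<close> to
      \<open>a\<close>. Thus \<open>a\<close> sees \<open>i\<close> and \<open>l\<close> but not
      \<open>j\<close>.\<close>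
    have "E a l"
      using inv[of l a b] a b I W neq a_neq \<open>a < b\<close> sym by auto
    moreover have "\<not> E a j"
      using noninv[of j a l] False W neq no a a_neq sym by auto
    ultimately show False
      using gap[of a i j l] a W neq a_neq sym by auto
  qed
qed

section \<open>Translation back to \<open>J\<close> and \<rho>\<close>

lemma Inv_not_alternating:
  assumes "realizable n k J" "admissible_order n k J \<rho>" "W \<in> C n (k + 2)"
    and ijl: "i \<in> W" "j \<in> W" "l \<in> W" "i < j" "j < l"
    and alt: "(W - {i} \<in> Inv n k J \<rho>) \<noteq> (W - {j} \<in> Inv n k J \<rho>)"
      "(W - {j} \<in> Inv n k J \<rho>) \<noteq> (W - {l} \<in> Inv n k J \<rho>)"
  shows False
proof -
  have lin: "trans \<rho>" "antisym \<rho>"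
    using assms(2) by (auto simp: admissible_order_def linear_order_on_def partial_order_on_def
        preorder_on_def)
  have X: "W - {i} \<in> C n (k + 1)" if "i \<in> W" for i
    using that assms(3) by (auto simp: C_def)
  have swap: "W - {i} - {j} = W - {j} - {i}" for i j
    by auto
  \<comment> \<open>As \<rho> is reflexive on \<open>J\<close>, a three-cycle is absurd only if two
    of its members differ.\<close>
  have cyc: False
    if "(Y, Z) \<in> \<rho>" "(Z, V) \<in> \<rho>" "(V, Y) \<in> \<rho>" "Y \<noteq> Z" for Y Z V
    using that lin by (metis antisymD transD)
  show False
  proof (rule inversions_not_alternating[where W = W and E = "\<lambda>i j. W - {i} - {j} \<in> J"
        and I = "\<lambda>i. W - {i} \<in> Inv n k J \<rho>" and R = "\<lambda>i a b. (W - {i} - {a}, W - {i} - {b}) \<in> \<rho>",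
        OF _ _ _ _ _ _ _ ijl alt])
    show "W - {i} - {j} \<in> J \<longleftrightarrow> W - {j} - {i} \<in> J" for i j
      by (simp add: swap)
    show "(\<forall>a\<in>W - {i}. \<forall>b\<in>W - {i}. a < b \<longrightarrow> W - {i} - {a} \<in> J \<longrightarrow> W - {i} - {b} \<in> J) \<or>
      (\<forall>a\<in>W - {i}. \<forall>b\<in>W - {i}. a < b \<longrightarrow> W - {i} - {b} \<in> J \<longrightarrow> W - {i} - {a} \<in> J)"
      if "i \<in> W" for i
      using assms(1) X[OF that] is_prefix_packet_iff[OF X[OF that], of J]
        is_suffix_packet_iff[OF X[OF that], of J] unfolding realizable_def by blast
    show "\<exists>a\<in>W - {i}. W - {i} - {a} \<in> J" if "i \<in> W" "W - {i} \<in> Inv n k J \<rho>" for i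
      using Inv_meets_packet[OF that(2)] X[OF that(1)] by (fastforce simp: C_def)
    show False if "i \<in> W" "j \<in> W" "l \<in> W" "i < j" "j < l"
      "(W - {i} - {j}, W - {i} - {l}) \<in> \<rho>" "(W - {l} - {i}, W - {l} - {j}) \<in> \<rho>"
      "(W - {j} - {l}, W - {j} - {i}) \<in> \<rho>" for i j l
    proof -
      have "W - {i} - {j} \<noteq> W - {i} - {l}"
        using that(2-5) by auto
      then show False
        using cyc[of "W - {i} - {j}" "W - {i} - {l}" "W - {j} - {l}"] that(6-8)
        by (simp add: swap[of l] swap[of j i])
    qed
    show False if "i \<in> W" "j \<in> W" "l \<in> W" "i < j" "j < l"
      "(W - {i} - {l}, W - {i} - {j}) \<in> \<rho>" "(W - {l} - {j}, W - {l} - {i}) \<in> \<rho>"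
      "(W - {j} - {i}, W - {j} - {l}) \<in> \<rho>" for i j l
    proof -
      have "W - {i} - {l} \<noteq> W - {i} - {j}"
        using that(2-5) by auto
      then show False
        using cyc[of "W - {i} - {l}" "W - {i} - {j}" "W - {j} - {l}"] that(6-8)
        by (simp add: swap[of l] swap[of j i])
    qed
  qed (use InvD[OF assms(2)] not_InvD[OF assms(1,2) X] in auto)
qed

theorem theorem3p18:
  fixes n k :: nat and J :: "nat set set" and \<rho> :: "nat set rel"
  assumes "k \<ge> 2"
    and "J \<subseteq> C n k"
    and "realizable n k J"
    and "admissible_order n k J \<rho>"
  shows "realizable n (k + 1) (Inv n k J \<rho>)"
  unfolding realizable_def
proof (intro conjI ballI)
  show "Inv n k J \<rho> \<subseteq> C n (k + 1)"
    by (auto simp: Inv_def suffix_part_def full_part_def)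
next
  fix W assume W: "W \<in> C n (k + 1 + 1)"
  then have W2: "W \<in> C n (k + 2)"
    by simp
  let ?I = "\<lambda>i. W - {i} \<in> Inv n k J \<rho>"
  note no_alt = Inv_not_alternating[OF assms(3,4) W2]
  have "(\<forall>a\<in>W. \<forall>b\<in>W. a < b \<longrightarrow> ?I a \<longrightarrow> ?I b) \<or> (\<forall>a\<in>W. \<forall>b\<in>W. a < b \<longrightarrow> ?I b \<longrightarrow> ?I a)"
  proof (rule ccontr)
    assume "\<not> ?thesis"
    \<comment> \<open>One pair loses membership upwards, the other gains it. Comparing the tops
      \<open>f\<close> and \<open>d\<close> gives an alternating triple, \<open>c < d < f\<close> or
      \<open>e < f < d\<close>.\<close>
    then obtain e f c d where ef: "e \<in> W" "f \<in> W" "e < f" "?I e" "\<not> ?I f"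
      and cd: "c \<in> W" "d \<in> W" "c < d" "\<not> ?I c" "?I d"
      by blast
    have "f \<noteq> d"
      using ef cd by auto
    then consider "d < f" | "f < d"
      by linarith
    then show False
    proof cases
      case 1
      then show False
        using no_alt[of c d f] ef cd by blast
    next
      case 2
      then show False
        using no_alt[of e f d] ef cd by blast
    qed
  qed
  then show "is_prefix lex_order (packet n (k + 1) W) (packet n (k + 1) W \<inter> Inv n k J \<rho>) \<or>
      is_suffix lex_order (packet n (k + 1) W) (packet n (k + 1) W \<inter> Inv n k J \<rho>)"
    by (simp only: is_prefix_packet_iff[OF W] is_suffix_packet_iff[OF W])
qed

end
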